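(* Let $\Sigma,U$ be real Hilbert spaces with a bounded, symmetric, positive definite bilinear form $a:\Sigma\times\Sigma\to\mathbb R$ and a bounded bilinear form $b:\Sigma\times U\to\mathbb R$. Let $\Sigma_h\subseteq\Sigma$ and $U_h\subseteq U$ be finite-dimensional subspaces such that $Z_h\subseteq Z$, where $$Z=\{\tau\in\Sigma: b(\tau,v)=0\ \forall v\in U\},\qquad Z_h=\{\tau_h\in\Sigma_h: b(\tau_h,v_h)=0\ \forall v_h\in U_h\},$$ and let $P_h:U\to U_h$ be a linear projection satisfying $b(\tau_h,v-P_hv)=0$ for all $(\tau_h,v)\in\Sigma_h\times U$. Then every $v\in U_0$ satisfies $$G_hP_hv=\mathfrak P_hGv .$$
   Context: Let $\|\cdot\|_a=a(\cdot,\cdot)^{1/2}$ and let $\overline\Sigma$ be the closure (completion) of $\Sigma$ with respect to $\|\cdot\|_a$, to which $a$ is extended by continuity. $U_0\subseteq U$ is the space of all $v\in U$ for which there exists a (then unique) $Gv\in\overline\Sigma$ with $a(Gv,\tau)=-b(\tau,v)$ for all $\tau\in\Sigma$. For $v\in U$, $G_hv\in\Sigma_h$ is the unique solution to $a(G_hv,\tau_h)=-b(\tau_h,v)$ for all $\tau_h\in\Sigma_h$. $\mathfrak P_h$ is the orthogonal projection onto the finite-dimensional space $\Sigma_h$ with respect to the inner product $a$, defined on $\overline\Sigma$. The inclusion $Z_h\subseteq Z$ guarantees that a projection $P_h$ as in the claim exists. *)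

theory Defs
  imports "HOL-Analysis.Analysis"
begin

definition finite_dim_subspace :: "'a::real_vector set \<Rightarrow> bool" where
  "finite_dim_subspace S \<longleftrightarrow> subspace S \<and> (\<exists>B. finite B \<and> span B = S)"

definition positive_definite_form :: "('s::real_vector \<Rightarrow> 's \<Rightarrow> real) \<Rightarrow> bool" where
  "positive_definite_form a \<longleftrightarrow> (\<forall>\<sigma>. \<sigma> \<noteq> 0 \<longrightarrow> 0 < a \<sigma> \<sigma>)"

text \<open>The kernel inside \<open>S\<close> of the form \<open>b\<close> tested against \<open>V\<close>:
  \<open>Z = b_kernel b UNIV UNIV\<close> and \<open>Z\<^sub>h = b_kernel b \<Sigma>\<^sub>h U\<^sub>h\<close>.\<close>

definition b_kernel :: "('s \<Rightarrow> 'u \<Rightarrow> real) \<Rightarrow> 's set \<Rightarrow> 'u set \<Rightarrow> 's set" where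
  "b_kernel b S V = {\<tau> \<in> S. \<forall>v\<in>V. b \<tau> v = 0}"

text \<open>A Hilbert space \<open>'c\<close>, together with an embedding \<open>\<iota>\<close> of \<open>\<Sigma>\<close>, is a completion of \<open>\<Sigma>\<close> with
  respect to the norm \<open>sqrt (a \<sigma> \<sigma>)\<close> if \<open>\<iota>\<close> is linear, carries \<open>a\<close> to the inner product, and
  has dense range.  The inner product of \<open>'c\<close> is then the unique continuous extension of \<open>a\<close>.
  Completions are unique up to isometric isomorphism.  One exists already with \<open>'c = 's\<close> for
  every bounded symmetric positive definite \<open>a\<close> on a Hilbert space \<open>'s\<close>: take for \<open>\<iota>\<close> the
  square root of the (injective, positive) operator that represents \<open>a\<close>.\<close>

definition energy_completion ::
    "('s::real_vector \<Rightarrow> 's \<Rightarrow> real) \<Rightarrow> ('s \<Rightarrow> 'c::{real_inner, complete_space}) \<Rightarrow> bool" where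
  "energy_completion a \<iota> \<longleftrightarrow>
     linear \<iota> \<and> (\<forall>\<sigma> \<tau>. \<iota> \<sigma> \<bullet> \<iota> \<tau> = a \<sigma> \<tau>) \<and> closure (range \<iota>) = UNIV"

definition U0 :: "('s \<Rightarrow> 'c::real_inner) \<Rightarrow> ('s \<Rightarrow> 'u \<Rightarrow> real) \<Rightarrow> 'u set" where
  "U0 \<iota> b = {v. \<exists>g. \<forall>\<tau>. g \<bullet> \<iota> \<tau> = - b \<tau> v}"

text \<open>\<open>grad \<iota> b v\<close> is \<open>G v\<close>; it is meaningful for \<open>v \<in> U0 \<iota> b\<close>, uniqueness
  coming from the density of \<open>range \<iota>\<close>.\<close>

definition grad :: "('s \<Rightarrow> 'c::real_inner) \<Rightarrow> ('s \<Rightarrow> 'u \<Rightarrow> real) \<Rightarrow> 'u \<Rightarrow> 'c" where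
  "grad \<iota> b v = (THE g. \<forall>\<tau>. g \<bullet> \<iota> \<tau> = - b \<tau> v)"

text \<open>\<open>grad_h a b \<Sigma>\<^sub>h v\<close> is \<open>G\<^sub>h v\<close>; it is defined by the original form \<open>a\<close>, and it is an
  element of \<open>\<Sigma>\<^sub>h \<subseteq> \<Sigma>\<close>.\<close>

definition grad_h ::
    "('s \<Rightarrow> 's \<Rightarrow> real) \<Rightarrow> ('s \<Rightarrow> 'u \<Rightarrow> real) \<Rightarrow> 's set \<Rightarrow> 'u \<Rightarrow> 's" where
  "grad_h a b Sh v = (THE g. g \<in> Sh \<and> (\<forall>\<tau>\<in>Sh. a g \<tau> = - b \<tau> v))"

definition orthogonal_projection :: "'c::real_inner set \<Rightarrow> 'c \<Rightarrow> 'c" where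
  "orthogonal_projection W x = (THE p. p \<in> W \<and> (\<forall>w\<in>W. orthogonal (x - p) w))"

end

theory Submission
  imports Defs
begin

text \<open>Let \<open>\<iota> g\<close> be the projection of \<open>G v\<close> onto \<open>\<iota> ` \<Sigma>\<^sub>h\<close>, with \<open>g \<in> \<Sigma>\<^sub>h\<close>.  For \<open>\<tau> \<in> \<Sigma>\<^sub>h\<close> one has
  \<open>a g \<tau> = G v \<bullet> \<iota> \<tau> = - b \<tau> v = - b \<tau> (P\<^sub>h v)\<close>, which is the equation that characterises
  \<open>G\<^sub>h (P\<^sub>h v)\<close>.\<close>

text \<open>Gram-Schmidt turns a finite spanning set into a finite orthogonal one, \<open>C\<close>,
  and the Fourier sum of \<open>x\<close> over \<open>C\<close> is the required point. The vectors
  of \<open>C\<close> are not normalised, hence the division by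
  \<open>c \<bullet> c\<close>.\<close>

lemma finite_dim_projection_exists:
  fixes W :: "'c::real_inner set"
  assumes "finite_dim_subspace W"
  obtains p where "p \<in> W" "\<And>w. w \<in> W \<Longrightarrow> orthogonal (x - p) w"
proof -
  obtain B where "finite B" "span B = W"
    using assms by (auto simp: finite_dim_subspace_def)
  then obtain C where C: "finite C" "span C = W" "pairwise orthogonal C"
    using basis_orthogonal[of B] by auto
  define p where "p = (\<Sum>c\<in>C. (c \<bullet> x / (c \<bullet> c)) *\<^sub>R c)"
  show thesis
  proof
    show "p \<in> W"
      unfolding p_def C(2)[symmetric] by (intro span_sum span_mul span_base)
    have "orthogonal (x - p) c" if "c \<in> C" for c
    proof -
      have "p \<bullet> c = (\<Sum>d\<in>C. if d = c then c \<bullet> x else 0)"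
        unfolding p_def inner_sum_left
      proof (rule sum.cong)
        fix d assume "d \<in> C"
        \<comment> \<open>\<open>C\<close> may contain 0. For \<open>d = c = 0\<close> the quotient
          is 0 by the convention for division by zero, and \<open>c \<bullet> x\<close> is 0 as
          well.\<close>
        then show "(d \<bullet> x / (d \<bullet> d)) *\<^sub>R d \<bullet> c = (if d = c then c \<bullet> x else 0)"
          using C(3) that by (auto simp: pairwise_def orthogonal_def)
      qed simp
      also have "\<dots> = x \<bullet> c"
        using C(1) that by (simp add: inner_commute)
      finally show ?thesis
        by (simp add: orthogonal_def inner_diff_left)
    qed
    then show "orthogonal (x - p) w" if "w \<in> W" for w
      using that by (intro orthogonal_to_span[of w C]) (simp_all add: C(2))
  qed
qed

text \<open>For two candidates \<open>p\<close> and \<open>q\<close>, the vector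
  \<open>q - p\<close> lies in \<open>W\<close> and is thus orthogonal to both residuals. It is also
  the difference of these residuals, so it is orthogonal to itself.\<close>

lemma orthogonal_projection_eqI:
  assumes "subspace W" "p \<in> W" "\<And>w. w \<in> W \<Longrightarrow> orthogonal (x - p) w"
  shows "orthogonal_projection W x = p"
  unfolding orthogonal_projection_def
proof (rule the_equality)
  fix q assume q: "q \<in> W \<and> (\<forall>w\<in>W. orthogonal (x - q) w)"
  then have "q - p \<in> W"
    using assms(1,2) by (simp add: subspace_diff)
  then have "(x - p) \<bullet> (q - p) = 0" "(x - q) \<bullet> (q - p) = 0"
    using assms(3) q by (auto simp: orthogonal_def)
  then have "(q - p) \<bullet> (q - p) = 0"
    by (simp add: inner_diff_left)
  then show "q = p" by simp
qed (use assms in auto)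

text \<open>Uniqueness comes from positive definiteness: the difference of two solutions is itself
  an admissible test element in \<open>Sh\<close>.\<close>

lemma grad_h_eqI:
  assumes "bounded_bilinear a" "positive_definite_form a" "subspace Sh"
    and "g \<in> Sh" "\<And>\<tau>. \<tau> \<in> Sh \<Longrightarrow> a g \<tau> = - b \<tau> v"
  shows "grad_h a b Sh v = g"
  unfolding grad_h_def
proof (rule the_equality)
  fix f assume f: "f \<in> Sh \<and> (\<forall>\<tau>\<in>Sh. a f \<tau> = - b \<tau> v)"
  then have "f - g \<in> Sh"
    using assms(3,4) by (simp add: subspace_diff)
  then have "a (f - g) (f - g) = 0"
    using f assms(5) by (simp add: bounded_bilinear.diff_left[OF assms(1)])
  then show "f = g"
    using assms(2) by (metis less_irrefl positive_definite_form_def right_minus_eq)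
qed (use assms in auto)

text \<open>Membership in \<open>U0\<close> supplies a representer, and density of the range makes
  it unique, so the definite description in \<open>grad\<close> denotes it.\<close>

lemma grad_inner:
  assumes "closure (range \<iota>) = UNIV" "v \<in> U0 \<iota> b"
  shows "grad \<iota> b v \<bullet> \<iota> \<tau> = - b \<tau> v"
proof -
  obtain g where g: "\<And>\<tau>. g \<bullet> \<iota> \<tau> = - b \<tau> v"
    using assms(2) by (auto simp: U0_def)
  have "grad \<iota> b v = g"
    unfolding grad_def
  proof (rule the_equality)
    fix f assume f: "\<forall>\<tau>. f \<bullet> \<iota> \<tau> = - b \<tau> v"
    \<comment> \<open>The hyperplane orthogonal to \<open>f - g\<close> is closed and contains the
      dense range, so it is the whole space and contains \<open>f - g\<close> itself.\<close>
    have "closure (range \<iota>) \<subseteq> {z. (f - g) \<bullet> z = 0}"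
      using f g by (intro closure_minimal closed_hyperplane) (auto simp: inner_diff_left)
    then have "(f - g) \<bullet> (f - g) = 0"
      using assms(1) by blast
    then show "f = g" by simp
  qed (use g in auto)
  then show ?thesis using g by simp
qed

lemma finite_dim_subspace_linear_image:
  assumes "linear f" "finite_dim_subspace S"
  shows "finite_dim_subspace (f ` S)"
proof -
  obtain B where B: "finite B" "span B = S" and "subspace S"
    using assms(2) by (auto simp: finite_dim_subspace_def)
  then have "subspace (f ` S)" "span (f ` B) = f ` S"
    using linear_subspace_image[OF assms(1)] linear_span_image[OF assms(1)] by auto
  then show ?thesis
    using B(1) unfolding finite_dim_subspace_def by blast
qed

theorem lemma2p5:
  fixes a :: "'s::{real_inner, complete_space} \<Rightarrow> 's \<Rightarrow> real"
    and b :: "'s \<Rightarrow> 'u::{real_inner, complete_space} \<Rightarrow> real"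
    and \<iota> :: "'s \<Rightarrow> 'c::{real_inner, complete_space}"
    and Sh :: "'s set" and Uh :: "'u set"
    and P :: "'u \<Rightarrow> 'u"
  assumes a_bounded: "bounded_bilinear a"
    and a_sym: "\<forall>\<sigma> \<tau>. a \<sigma> \<tau> = a \<tau> \<sigma>"
    and a_posdef: "positive_definite_form a"
    and b_bounded: "bounded_bilinear b"
    and completion: "energy_completion a \<iota>"
    and Sh: "finite_dim_subspace Sh"
    and Uh: "finite_dim_subspace Uh"
    and kernels: "b_kernel b Sh Uh \<subseteq> b_kernel b UNIV UNIV"
    and P_linear: "linear P"
    and P_into: "\<forall>v. P v \<in> Uh"
    and P_proj: "\<forall>v\<in>Uh. P v = v"
    and P_orth: "\<forall>\<tau>\<in>Sh. \<forall>v. b \<tau> (v - P v) = 0"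
  shows "\<forall>v \<in> U0 \<iota> b.
    \<iota> (grad_h a b Sh (P v)) = orthogonal_projection (\<iota> ` Sh) (grad \<iota> b v)"
proof
  fix v assume v: "v \<in> U0 \<iota> b"
  have \<iota>: "linear \<iota>" "\<And>\<sigma> \<tau>. \<iota> \<sigma> \<bullet> \<iota> \<tau> = a \<sigma> \<tau>" "closure (range \<iota>) = UNIV"
    using completion by (auto simp: energy_completion_def)
  have fin: "finite_dim_subspace (\<iota> ` Sh)"
    using \<iota>(1) Sh by (rule finite_dim_subspace_linear_image)
  obtain g where g: "g \<in> Sh"
    and orth: "\<And>w. w \<in> \<iota> ` Sh \<Longrightarrow> orthogonal (grad \<iota> b v - \<iota> g) w"
    using finite_dim_projection_exists[OF fin, of "grad \<iota> b v"] by blast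
  have "a g \<tau> = - b \<tau> (P v)" if "\<tau> \<in> Sh" for \<tau>
  proof -
    \<comment> \<open>The residual \<open>grad \<iota> b v - \<iota> g\<close> is orthogonal to
      \<open>\<iota> \<tau>\<close>, and \<open>\<iota>\<close> carries \<open>a\<close> to the
      inner product.\<close>
    have "a g \<tau> = grad \<iota> b v \<bullet> \<iota> \<tau>"
      using orth[of "\<iota> \<tau>"] that by (simp add: orthogonal_def inner_diff_left \<iota>(2))
    also have "\<dots> = - b \<tau> v"
      using \<iota>(3) v by (rule grad_inner)
    also have "\<dots> = - b \<tau> (P v)"
      using P_orth[rule_format, OF that, of v]
      unfolding bounded_bilinear.diff_right[OF b_bounded] by linarith
    finally show ?thesis .
  qed
  then have "grad_h a b Sh (P v) = g"
    using a_bounded a_posdef Sh g by (intro grad_h_eqI) (auto simp: finite_dim_subspace_def)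
  moreover have "orthogonal_projection (\<iota> ` Sh) (grad \<iota> b v) = \<iota> g"
    using fin g orth by (intro orthogonal_projection_eqI) (auto simp: finite_dim_subspace_def)
  ultimately show "\<iota> (grad_h a b Sh (P v)) = orthogonal_projection (\<iota> ` Sh) (grad \<iota> b v)"
    by simp
qed

end
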